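(* There does not exist a Sasaki-like almost contact complex Riemannian manifold $(\mathcal{M},\varphi,\xi,\eta,g)$ equipped with a $\tilde g$-generated Yamabe almost soliton having a vertical potential, where $\tilde g$ is the associated B-metric of $g$. That is, on a Sasaki-like almost contact complex Riemannian manifold $(\mathcal{M},\varphi,\xi,\eta,g)$ there are no vector field $\tilde\vartheta=\tilde k\,\xi$, with $\tilde k$ a differentiable function on $\mathcal{M}$ satisfying $\tilde k(p)\neq 0$ at every point $p\in\mathcal{M}$, and differentiable function $\tilde\lambda$ on $\mathcal{M}$ such that $\frac12\mathcal{L}_{\tilde\vartheta}\tilde g=(\tilde\tau-\tilde\lambda)\tilde g$, where $\tilde\tau$ is the scalar curvature of $\tilde g$.
   Context: An almost contact complex Riemannian (accR) manifold, also called an almost contact B-metric manifold, $(\mathcal{M},\varphi,\xi,\eta,g)$ is a differentiable (smooth, nonempty) manifold $\mathcal{M}$ of dimension $2n+1$, $n\geq 1$, with an endomorphism $\varphi$ of the tangent bundle $T\mathcal{M}$, a vector field $\xi$ (the Reeb vector field), a 1-form $\eta$ and a pseudo-Riemannian metric $g$ of signature $(n+1,n)$ such that $$\varphi\xi=0,\quad \varphi^2=-\mathrm{Id}+\eta\otimes\xi,\quad \eta\circ\varphi=0,\quad \eta(\xi)=1,\quad g(\varphi x,\varphi y)=-g(x,y)+\eta(x)\eta(y)$$ for all vector fields $x,y$. The associated B-metric $\tilde g$ is the pseudo-Riemannian metric $\tilde g(x,y)=g(x,\varphi y)+\eta(x)\eta(y)$. Let $\nabla$ be the Levi-Civita connection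 of $g$. The accR manifold is called Sasaki-like (a condition on $g$) if $$(\nabla_x\varphi)y=\eta(y)\varphi^2x+g(\varphi x,\varphi y)\xi$$ for all vector fields $x,y$. A Yamabe almost soliton generated by $\tilde g$, denoted $(\tilde g;\tilde\vartheta,\tilde\lambda)$, consists of a vector field $\tilde\vartheta$ (the potential) and a differentiable function $\tilde\lambda$ (the soliton function) on $\mathcal{M}$ with $\frac12\mathcal{L}_{\tilde\vartheta}\tilde g=(\tilde\tau-\tilde\lambda)\tilde g$, where $\mathcal{L}$ is the Lie derivative and $\tilde\tau$ is the scalar curvature of $\tilde g$. The potential is vertical if $\tilde\vartheta=\tilde k\,\xi$ for a differentiable function $\tilde k$ on $\mathcal{M}$ with $\tilde k(p)\neq0$ at every point $p\in\mathcal{M}$. *)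

theory Defs
  imports "HOL-Analysis.Analysis"
begin

section \<open>Smooth manifolds\<close>

fun Ck_on :: "nat \<Rightarrow> 'a::real_normed_vector set \<Rightarrow> ('a \<Rightarrow> 'b::real_normed_vector) \<Rightarrow> bool" where
  "Ck_on 0 S f \<longleftrightarrow> continuous_on S f"
| "Ck_on (Suc k) S f \<longleftrightarrow> (\<forall>x\<in>S. f differentiable (at x)) \<and>
     (\<forall>v. Ck_on k S (\<lambda>x. frechet_derivative f (at x) v))"

text \<open>Only used for open sets.\<close>

definition smooth_on :: "'a::real_normed_vector set \<Rightarrow> ('a \<Rightarrow> 'b::real_normed_vector) \<Rightarrow> bool" where
  "smooth_on S f \<longleftrightarrow> (\<forall>k. Ck_on k S f)"

text \<open>The dimension of the manifold is the cardinality of the index type \<open>'m\<close>. The atlas need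
  not be maximal; it determines the same smooth functions as the maximal one containing it.\<close>

record ('a, 'm) mfd =
  mtop :: "'a topology"
  charts :: "('a set \<times> ('a \<Rightarrow> real ^ 'm)) set"

abbreviation points :: "('a, 'm::finite) mfd \<Rightarrow> 'a set" where
  "points M \<equiv> topspace (mtop M)"

definition smooth_manifold :: "('a, 'm::finite) mfd \<Rightarrow> bool" where
  "smooth_manifold M \<longleftrightarrow>
     points M \<noteq> {} \<and> Hausdorff_space (mtop M) \<and> second_countable (mtop M) \<and>
     (\<Union>(U, c)\<in>charts M. U) = points M \<and>
     (\<forall>(U, c)\<in>charts M. openin (mtop M) U \<and> open (c ` U) \<and>
        homeomorphic_map (subtopology (mtop M) U) (top_of_set (c ` U)) c) \<and>
     (\<forall>(U, c)\<in>charts M. \<forall>(V, d)\<in>charts M. smooth_on (c ` (U \<inter> V)) (d \<circ> inv_into U c))"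

text \<open>Real functions on the manifold are represented by functions on the whole type that vanish
  off the manifold, so that equality of functions is equality on the manifold.\<close>

definition smooth_funs :: "('a, 'm::finite) mfd \<Rightarrow> ('a \<Rightarrow> real) set" where
  "smooth_funs M = {f. (\<forall>(U, c)\<in>charts M. smooth_on (c ` U) (f \<circ> inv_into U c)) \<and>
     (\<forall>p. p \<notin> points M \<longrightarrow> f p = 0)}"

section \<open>Vector fields\<close>

text \<open>A tangent vector at \<open>p\<close> is a derivation at \<open>p\<close> of the algebra of smooth functions; a vector
  field is a smooth section of the tangent spaces, written as the operator \<open>f \<mapsto> (p \<mapsto> X\<^sub>p f)\<close>.
  The value on arguments that are not smooth functions is set to \<open>0\<close>, again to make equality
  extensional.\<close>

definition tangent_space :: "('a, 'm::finite) mfd \<Rightarrow> 'a \<Rightarrow> (('a \<Rightarrow> real) \<Rightarrow> real) set" where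
  "tangent_space M p = {v.
     (\<forall>a b. \<forall>f\<in>smooth_funs M. \<forall>h\<in>smooth_funs M. v (\<lambda>q. a * f q + b * h q) = a * v f + b * v h) \<and>
     (\<forall>f\<in>smooth_funs M. \<forall>h\<in>smooth_funs M. v (\<lambda>q. f q * h q) = v f * h p + f p * v h) \<and>
     (\<forall>f. f \<notin> smooth_funs M \<longrightarrow> v f = 0)}"

type_synonym 'a vfield = "('a \<Rightarrow> real) \<Rightarrow> 'a \<Rightarrow> real"

definition vfields :: "('a, 'm::finite) mfd \<Rightarrow> 'a vfield set" where
  "vfields M = {X. (\<forall>p\<in>points M. (\<lambda>f. X f p) \<in> tangent_space M p) \<and>
     (\<forall>f\<in>smooth_funs M. X f \<in> smooth_funs M) \<and>
     (\<forall>f. f \<notin> smooth_funs M \<longrightarrow> X f = (\<lambda>p. 0))}"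

definition vadd :: "'a vfield \<Rightarrow> 'a vfield \<Rightarrow> 'a vfield" where
  "vadd X Y = (\<lambda>f p. X f p + Y f p)"

definition vsub :: "'a vfield \<Rightarrow> 'a vfield \<Rightarrow> 'a vfield" where
  "vsub X Y = (\<lambda>f p. X f p - Y f p)"

definition vscale :: "('a \<Rightarrow> real) \<Rightarrow> 'a vfield \<Rightarrow> 'a vfield" where
  "vscale k X = (\<lambda>f p. k p * X f p)"

definition vzero :: "'a vfield" where
  "vzero = (\<lambda>f p. 0)"

definition lie_bracket :: "'a vfield \<Rightarrow> 'a vfield \<Rightarrow> 'a vfield" where
  "lie_bracket X Y = (\<lambda>f p. X (Y f) p - Y (X f) p)"

definition tangent_frame_at :: "('a, 'm::finite) mfd \<Rightarrow> 'a \<Rightarrow> ('m \<Rightarrow> 'a vfield) \<Rightarrow> bool" where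
  \<comment> \<open>smooth vector fields whose values at \<open>p\<close> form a basis of the tangent space at \<open>p\<close>\<close>
  "tangent_frame_at M p E \<longleftrightarrow> (\<forall>i. E i \<in> vfields M) \<and>
     (\<forall>v\<in>tangent_space M p. \<exists>!a::real ^ 'm. \<forall>f. v f = (\<Sum>i\<in>UNIV. a $ i * E i f p))"

section \<open>Tensor fields\<close>

text \<open>Tensor fields are maps on vector fields that are multilinear over the smooth functions.\<close>

type_synonym 'a oneform = "'a vfield \<Rightarrow> 'a \<Rightarrow> real"
type_synonym 'a endo = "'a vfield \<Rightarrow> 'a vfield"
type_synonym 'a bilin = "'a vfield \<Rightarrow> 'a vfield \<Rightarrow> 'a \<Rightarrow> real"
type_synonym 'a conn = "'a vfield \<Rightarrow> 'a vfield \<Rightarrow> 'a vfield"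

definition one_form :: "('a, 'm::finite) mfd \<Rightarrow> 'a oneform \<Rightarrow> bool" where
  "one_form M \<omega> \<longleftrightarrow>
     (\<forall>X\<in>vfields M. \<omega> X \<in> smooth_funs M) \<and>
     (\<forall>X\<in>vfields M. \<forall>Y\<in>vfields M. \<omega> (vadd X Y) = (\<lambda>p. \<omega> X p + \<omega> Y p)) \<and>
     (\<forall>f\<in>smooth_funs M. \<forall>X\<in>vfields M. \<omega> (vscale f X) = (\<lambda>p. f p * \<omega> X p))"

definition endomorphism_field :: "('a, 'm::finite) mfd \<Rightarrow> 'a endo \<Rightarrow> bool" where
  "endomorphism_field M F \<longleftrightarrow>
     (\<forall>X\<in>vfields M. F X \<in> vfields M) \<and>
     (\<forall>X\<in>vfields M. \<forall>Y\<in>vfields M. F (vadd X Y) = vadd (F X) (F Y)) \<and>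
     (\<forall>f\<in>smooth_funs M. \<forall>X\<in>vfields M. F (vscale f X) = vscale f (F X))"

definition bilinear_form_field :: "('a, 'm::finite) mfd \<Rightarrow> 'a bilin \<Rightarrow> bool" where
  "bilinear_form_field M b \<longleftrightarrow>
     (\<forall>X\<in>vfields M. one_form M (b X)) \<and> (\<forall>Y\<in>vfields M. one_form M (\<lambda>X. b X Y))"

definition has_signature_at ::
  "('a, 'm::finite) mfd \<Rightarrow> 'a bilin \<Rightarrow> 'a \<Rightarrow> nat \<Rightarrow> nat \<Rightarrow> bool" where
  "has_signature_at M g p r s \<longleftrightarrow> (\<exists>E. tangent_frame_at M p E \<and>
     (\<forall>i j. i \<noteq> j \<longrightarrow> g (E i) (E j) p = 0) \<and>
     (\<forall>i. g (E i) (E i) p = 1 \<or> g (E i) (E i) p = - 1) \<and>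
     card {i. g (E i) (E i) p = 1} = r \<and> card {i. g (E i) (E i) p = - 1} = s)"

definition pseudo_riemannian_metric ::
  "('a, 'm::finite) mfd \<Rightarrow> 'a bilin \<Rightarrow> nat \<Rightarrow> nat \<Rightarrow> bool" where
  "pseudo_riemannian_metric M g r s \<longleftrightarrow> bilinear_form_field M g \<and>
     (\<forall>X\<in>vfields M. \<forall>Y\<in>vfields M. g X Y = g Y X) \<and>
     (\<forall>p\<in>points M. has_signature_at M g p r s)"

section \<open>Connections, curvature and the Lie derivative\<close>

definition affine_connection :: "('a, 'm::finite) mfd \<Rightarrow> 'a conn \<Rightarrow> bool" where
  "affine_connection M D \<longleftrightarrow>
     (\<forall>Y\<in>vfields M. endomorphism_field M (\<lambda>X. D X Y)) \<and>
     (\<forall>X\<in>vfields M. \<forall>Y\<in>vfields M. \<forall>Z\<in>vfields M. D X (vadd Y Z) = vadd (D X Y) (D X Z)) \<and>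
     (\<forall>f\<in>smooth_funs M. \<forall>X\<in>vfields M. \<forall>Y\<in>vfields M.
        D X (vscale f Y) = vadd (vscale (X f) Y) (vscale f (D X Y)))"

definition levi_civita :: "('a, 'm::finite) mfd \<Rightarrow> 'a bilin \<Rightarrow> 'a conn \<Rightarrow> bool" where
  "levi_civita M g D \<longleftrightarrow> affine_connection M D \<and>
     (\<forall>X\<in>vfields M. \<forall>Y\<in>vfields M. vsub (D X Y) (D Y X) = lie_bracket X Y) \<and>
     (\<forall>X\<in>vfields M. \<forall>Y\<in>vfields M. \<forall>Z\<in>vfields M.
        X (g Y Z) = (\<lambda>p. g (D X Y) Z p + g Y (D X Z) p))"

definition curvature :: "'a conn \<Rightarrow> 'a vfield \<Rightarrow> 'a vfield \<Rightarrow> 'a vfield \<Rightarrow> 'a vfield" where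
  "curvature D X Y Z = vsub (vsub (D X (D Y Z)) (D Y (D X Z))) (D (lie_bracket X Y) Z)"

text \<open>The contraction \<open>g\<^sup>i\<^sup>j b(E\<^sub>i, E\<^sub>j)\<close> at \<open>p\<close>; it does not depend on the chosen frame.\<close>

definition metric_trace :: "('a, 'm::finite) mfd \<Rightarrow> 'a bilin \<Rightarrow> 'a bilin \<Rightarrow> 'a \<Rightarrow> real" where
  "metric_trace M g b p =
     (let E = (SOME E. tangent_frame_at M p E);
          G = (\<chi> i j. g (E i) (E j) p) :: real ^ 'm ^ 'm
      in \<Sum>i\<in>UNIV. \<Sum>j\<in>UNIV. matrix_inv G $ i $ j * b (E i) (E j) p)"

definition ricci :: "('a, 'm::finite) mfd \<Rightarrow> 'a bilin \<Rightarrow> 'a conn \<Rightarrow> 'a bilin" where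
  "ricci M g D Y Z = metric_trace M g (\<lambda>X W. g (curvature D X Y Z) W)"

text \<open>The Levi-Civita connection of a metric is unique as a map on vector fields, so the choice
  below does not affect the value.\<close>

definition scalar_curvature :: "('a, 'm::finite) mfd \<Rightarrow> 'a bilin \<Rightarrow> 'a \<Rightarrow> real" where
  "scalar_curvature M g = metric_trace M g (ricci M g (SOME D. levi_civita M g D))"

definition lie_derivative :: "'a vfield \<Rightarrow> 'a bilin \<Rightarrow> 'a bilin" where
  "lie_derivative V b X Y =
     (\<lambda>p. V (b X Y) p - b (lie_bracket V X) Y p - b X (lie_bracket V Y) p)"

section \<open>Almost contact complex Riemannian manifolds and Yamabe almost solitons\<close>

definition accR_manifold ::
  "nat \<Rightarrow> ('a, 'm::finite) mfd \<Rightarrow> 'a endo \<Rightarrow> 'a vfield \<Rightarrow> 'a oneform \<Rightarrow> 'a bilin \<Rightarrow> bool" where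
  "accR_manifold n M \<phi> \<xi> \<eta> g \<longleftrightarrow>
     n \<ge> 1 \<and> CARD('m) = 2 * n + 1 \<and> smooth_manifold M \<and>
     endomorphism_field M \<phi> \<and> \<xi> \<in> vfields M \<and> one_form M \<eta> \<and>
     pseudo_riemannian_metric M g (n + 1) n \<and>
     \<phi> \<xi> = vzero \<and>
     (\<forall>x\<in>vfields M. \<phi> (\<phi> x) = vsub (vscale (\<eta> x) \<xi>) x) \<and>
     (\<forall>x\<in>vfields M. \<eta> (\<phi> x) = (\<lambda>p. 0)) \<and>
     (\<forall>p\<in>points M. \<eta> \<xi> p = 1) \<and>
     (\<forall>x\<in>vfields M. \<forall>y\<in>vfields M. g (\<phi> x) (\<phi> y) = (\<lambda>p. - g x y p + \<eta> x p * \<eta> y p))"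

definition associated_metric :: "'a endo \<Rightarrow> 'a oneform \<Rightarrow> 'a bilin \<Rightarrow> 'a bilin" where
  "associated_metric \<phi> \<eta> g x y = (\<lambda>p. g x (\<phi> y) p + \<eta> x p * \<eta> y p)"

text \<open>In the next definition \<open>D\<close> is the Levi-Civita connection of \<open>g\<close>, and
  \<open>(\<nabla>\<^sub>x \<phi>) y = \<nabla>\<^sub>x (\<phi> y) - \<phi> (\<nabla>\<^sub>x y)\<close>.\<close>

definition sasaki_like ::
  "('a, 'm::finite) mfd \<Rightarrow> 'a endo \<Rightarrow> 'a vfield \<Rightarrow> 'a oneform \<Rightarrow> 'a bilin \<Rightarrow> bool" where
  "sasaki_like M \<phi> \<xi> \<eta> g \<longleftrightarrow> (\<exists>D. levi_civita M g D \<and>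
     (\<forall>x\<in>vfields M. \<forall>y\<in>vfields M.
        vsub (D x (\<phi> y)) (\<phi> (D x y)) =
        vadd (vscale (\<eta> y) (\<phi> (\<phi> x))) (vscale (g (\<phi> x) (\<phi> y)) \<xi>)))"

definition yamabe_almost_soliton ::
  "('a, 'm::finite) mfd \<Rightarrow> 'a bilin \<Rightarrow> 'a vfield \<Rightarrow> ('a \<Rightarrow> real) \<Rightarrow> bool" where
  "yamabe_almost_soliton M g V l \<longleftrightarrow> V \<in> vfields M \<and> l \<in> smooth_funs M \<and>
     (\<forall>x\<in>vfields M. \<forall>y\<in>vfields M. \<forall>p\<in>points M.
        1 / 2 * lie_derivative V g x y p = (scalar_curvature M g p - l p) * g x y p)"

definition vertical_potential :: "('a, 'm::finite) mfd \<Rightarrow> 'a vfield \<Rightarrow> 'a vfield \<Rightarrow> bool" where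
  "vertical_potential M \<xi> V \<longleftrightarrow>
     (\<exists>k\<in>smooth_funs M. (\<forall>p\<in>points M. k p \<noteq> 0) \<and> V = vscale k \<xi>)"

end

theory Submission
  imports Defs
begin

text \<open>The soliton equation is already contradictory on the contact distribution, the image of
  \<open>\<phi>\<close>. Let \<open>V = k \<xi>\<close>, so that \<open>\<phi> V = 0\<close> and \<open>\<eta>(V) = k\<close>. The Sasaki-like condition
  gives \<open>\<phi>(\<nabla>\<^sub>x V) = k x\<close> and \<open>\<nabla>\<^sub>V (\<phi> x) = \<phi>(\<nabla>\<^sub>V x)\<close> for horizontal \<open>x\<close>
  (lemmas \<open>sasaki_like_phi_deriv\<close> and \<open>sasaki_like_deriv_phi\<close>). Writing the Lie derivative by
  means of \<open>\<nabla>\<close>, and using that \<open>\<phi>\<close> is self-adjoint for \<open>g\<close>, this yields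
  \<open>L\<^sub>V g'(x, y) = 2 k g(x, y)\<close> for horizontal \<open>x\<close> and \<open>y\<close>, where \<open>g'\<close> is the associated
  metric (lemma \<open>lie_derivative_associated_metric\<close>).

  The point is that the Lie derivative of \<open>g'\<close> is a multiple of \<open>g\<close>, whereas the soliton
  equation demands a multiple of \<open>g'\<close>: with \<open>s\<close> the difference of the scalar curvature and the
  soliton function, \<open>k g(x, y) = s g(x, \<phi> y)\<close>. Since \<open>\<phi>\<^sup>2 = -1\<close> on horizontal vectors,
  replacing \<open>y\<close> by \<open>\<phi> y\<close> gives \<open>k g(x, \<phi> y) = - s g(x, y)\<close>, hence
  \<open>(k\<^sup>2 + s\<^sup>2) g(x, y) = 0\<close>. A unit timelike vector \<open>e\<close>, which exists because \<open>n \<ge> 1\<close>,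
  has \<open>g(\<phi> e, \<phi> e) = 1 + \<eta>(e)\<^sup>2 > 0\<close>; so \<open>k = 0\<close> at every point, whereas \<open>k\<close>
  has no zeros and the manifold has a point.\<close>

section \<open>Differences of smooth functions and of vector fields\<close>

text \<open>The difference is given by a third function that agrees with it on \<open>S\<close> only, because the
  derivative of a difference is the difference of the derivatives at points of \<open>S\<close> only; with
  \<open>\<lambda>x. f x - h x\<close> in its place the induction would not go through.\<close>

lemma Ck_on_diff:
  assumes "open S"
  shows "\<lbrakk>Ck_on k S f; Ck_on k S h; \<And>x. x \<in> S \<Longrightarrow> u x = f x - h x\<rbrakk> \<Longrightarrow> Ck_on k S u"
proof (induction k arbitrary: f h u)
  case 0
  then have "continuous_on S (\<lambda>x. f x - h x)"
    by (auto intro: continuous_on_diff)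
  then show ?case
    using 0 by (simp cong: continuous_on_cong)
next
  case (Suc k)
  have deriv: "(u has_derivative
      (\<lambda>v. frechet_derivative f (at x) v - frechet_derivative h (at x) v)) (at x)"
    if "x \<in> S" for x
  proof -
    have "((\<lambda>x. f x - h x) has_derivative
      (\<lambda>v. frechet_derivative f (at x) v - frechet_derivative h (at x) v)) (at x)"
      using Suc.prems that by (intro has_derivative_diff) (auto simp flip: frechet_derivative_works)
    then show ?thesis
      by (rule has_derivative_transform_within_open[OF _ assms that]) (simp add: Suc.prems(3))
  qed
  have "Ck_on k S (\<lambda>x. frechet_derivative u (at x) v)" for v
  proof (rule Suc.IH)
    show "Ck_on k S (\<lambda>x. frechet_derivative f (at x) v)"
      and "Ck_on k S (\<lambda>x. frechet_derivative h (at x) v)"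
      using Suc.prems by auto
    show "frechet_derivative u (at x) v = frechet_derivative f (at x) v - frechet_derivative h (at x) v"
      if "x \<in> S" for x
      using frechet_derivative_at[OF deriv[OF that]] by metis
  qed
  then show ?case
    using deriv by (auto simp: differentiable_def)
qed

lemma smooth_funs_diff:
  assumes "smooth_manifold M" "f \<in> smooth_funs M" "h \<in> smooth_funs M"
  shows "(\<lambda>p. f p - h p) \<in> smooth_funs M"
proof -
  have "smooth_on (c ` U) ((\<lambda>p. f p - h p) \<circ> inv_into U c)" if "(U, c) \<in> charts M" for U c
  proof -
    have "open (c ` U)"
      using assms(1) that by (auto simp: smooth_manifold_def)
    moreover have "smooth_on (c ` U) (f \<circ> inv_into U c)" "smooth_on (c ` U) (h \<circ> inv_into U c)"
      using assms(2,3) that by (auto simp: smooth_funs_def)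
    ultimately have "Ck_on k (c ` U) ((\<lambda>p. f p - h p) \<circ> inv_into U c)" for k
      by - (rule Ck_on_diff[where f = "f \<circ> inv_into U c" and h = "h \<circ> inv_into U c"],
        simp_all add: smooth_on_def)
    then show ?thesis
      by (simp add: smooth_on_def)
  qed
  then show ?thesis
    using assms(2,3) by (auto simp: smooth_funs_def)
qed

lemma vfields_vsub:
  assumes "smooth_manifold M" "X \<in> vfields M" "Y \<in> vfields M"
  shows "vsub X Y \<in> vfields M"
proof -
  have "(\<lambda>f. X f p - Y f p) \<in> tangent_space M p" if "p \<in> points M" for p
  proof -
    have "(\<lambda>f. X f p) \<in> tangent_space M p" "(\<lambda>f. Y f p) \<in> tangent_space M p"
      using assms that by (auto simp: vfields_def)
    then show ?thesis
      by (auto simp: tangent_space_def algebra_simps)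
  qed
  then show ?thesis
    using assms smooth_funs_diff[OF assms(1)] by (auto simp: vfields_def vsub_def)
qed

lemma vadd_vsub_cancel: "vadd (vsub X Y) Y = X"
  by (simp add: vadd_def vsub_def)

lemma one_form_vsub:
  assumes "smooth_manifold M" "one_form M \<omega>" "X \<in> vfields M" "Y \<in> vfields M"
  shows "\<omega> (vsub X Y) p = \<omega> X p - \<omega> Y p"
proof -
  have "\<omega> (vadd (vsub X Y) Y) = (\<lambda>p. \<omega> (vsub X Y) p + \<omega> Y p)"
    using assms vfields_vsub[OF assms(1,3,4)] by (simp add: one_form_def)
  then show ?thesis
    by (simp add: vadd_vsub_cancel)
qed

lemma endomorphism_field_vsub:
  assumes "smooth_manifold M" "endomorphism_field M F" "X \<in> vfields M" "Y \<in> vfields M"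
  shows "F (vsub X Y) = vsub (F X) (F Y)"
proof -
  have "F (vadd (vsub X Y) Y) = vadd (F (vsub X Y)) (F Y)"
    using assms vfields_vsub[OF assms(1,3,4)] by (simp add: endomorphism_field_def)
  then show ?thesis
    by (simp add: vadd_vsub_cancel) (simp add: vadd_def vsub_def)
qed

lemma vadd_vzero: "vadd vzero vzero = vzero"
  by (simp add: vadd_def vzero_def)

lemma one_form_vzero:
  assumes "one_form M \<omega>" "vzero \<in> vfields M"
  shows "\<omega> vzero p = 0"
proof -
  have "\<omega> (vadd vzero vzero) = (\<lambda>p. \<omega> vzero p + \<omega> vzero p)"
    using assms by (simp add: one_form_def)
  from fun_cong[OF this, of p] show ?thesis
    by (simp add: vadd_vzero)
qed

lemma affine_connection_vzero:
  assumes "affine_connection M D" "X \<in> vfields M" "vzero \<in> vfields M"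
  shows "D X vzero = vzero"
proof -
  have "D X (vadd vzero vzero) = vadd (D X vzero) (D X vzero)"
    using assms by (simp add: affine_connection_def)
  then have "D X vzero f p = vadd (D X vzero) (D X vzero) f p" for f p
    by (simp add: vadd_vzero)
  then have "D X vzero f p = 0" for f p
    by (simp add: vadd_def)
  then show ?thesis
    by (simp add: vzero_def fun_eq_iff)
qed

lemma affine_connection_vfields:
  assumes "affine_connection M D" "X \<in> vfields M" "Y \<in> vfields M"
  shows "D X Y \<in> vfields M"
proof -
  have "\<forall>Y\<in>vfields M. endomorphism_field M (\<lambda>X. D X Y)"
    using assms(1) unfolding affine_connection_def by (elim conjE)
  from bspec[OF this assms(3)] have "\<forall>X\<in>vfields M. D X Y \<in> vfields M"
    unfolding endomorphism_field_def by (elim conjE)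
  then show ?thesis
    using assms(2) by (rule bspec)
qed

section \<open>The structure tensors\<close>

lemma accR_manifold_phi_vfields:
  assumes "accR_manifold n M \<phi> \<xi> \<eta> g" "x \<in> vfields M"
  shows "\<phi> x \<in> vfields M"
proof -
  have "endomorphism_field M \<phi>"
    using assms(1) unfolding accR_manifold_def by (elim conjE)
  then show ?thesis
    using assms(2) unfolding endomorphism_field_def by (elim conjE bspec)
qed

lemma accR_manifold_vzero:
  assumes "accR_manifold n M \<phi> \<xi> \<eta> g"
  shows "vzero \<in> vfields M"
proof -
  have "\<xi> \<in> vfields M" "\<phi> \<xi> = vzero"
    using assms unfolding accR_manifold_def by blast+
  then show ?thesis
    using accR_manifold_phi_vfields[OF assms, of \<xi>] by simp
qed

lemma accR_manifold_one_form:
  assumes "accR_manifold n M \<phi> \<xi> \<eta> g" "x \<in> vfields M"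
  shows "one_form M (g x)" "one_form M (\<lambda>y. g y x)"
proof -
  have "pseudo_riemannian_metric M g (n + 1) n"
    using assms(1) unfolding accR_manifold_def by (elim conjE)
  then have "bilinear_form_field M g"
    unfolding pseudo_riemannian_metric_def by (elim conjE)
  then have "\<forall>X\<in>vfields M. one_form M (g X)" "\<forall>Y\<in>vfields M. one_form M (\<lambda>X. g X Y)"
    unfolding bilinear_form_field_def by blast+
  then show "one_form M (g x)" "one_form M (\<lambda>y. g y x)"
    using assms(2) by (auto dest: bspec)
qed

lemma accR_manifold_g_phi_phi:
  assumes "accR_manifold n M \<phi> \<xi> \<eta> g" "x \<in> vfields M" "y \<in> vfields M"
  shows "g (\<phi> x) (\<phi> y) p = - g x y p + \<eta> x p * \<eta> y p"
proof -
  have "\<forall>x\<in>vfields M. \<forall>y\<in>vfields M. g (\<phi> x) (\<phi> y) = (\<lambda>p. - g x y p + \<eta> x p * \<eta> y p)"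
    using assms(1) unfolding accR_manifold_def by (elim conjE)
  from bspec[OF bspec[OF this assms(2)] assms(3)] show ?thesis
    by (rule fun_cong)
qed

text \<open>On horizontal fields \<open>\<phi>\<close> is a complex structure.\<close>

lemma accR_manifold_phi_phi_horizontal:
  assumes "accR_manifold n M \<phi> \<xi> \<eta> g" "x \<in> vfields M" "\<eta> x = (\<lambda>p. 0)"
  shows "\<phi> (\<phi> x) = (\<lambda>f p. - x f p)"
proof -
  have "\<forall>x\<in>vfields M. \<phi> (\<phi> x) = vsub (vscale (\<eta> x) \<xi>) x"
    using assms(1) unfolding accR_manifold_def by (elim conjE)
  from bspec[OF this assms(2)] show ?thesis
    by (simp add: assms(3) vsub_def vscale_def)
qed

text \<open>The compatibility of \<open>g\<close> with \<open>\<phi>\<close> gives \<open>g(\<phi> x, \<phi>\<^sup>2 y) = - g(x, \<phi> y)\<close>, while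
  \<open>\<phi>\<^sup>2 y + y\<close> is a multiple of \<open>\<xi>\<close>, which is orthogonal to the image of \<open>\<phi>\<close>.\<close>

lemma accR_manifold_phi_self_adjoint:
  assumes A: "accR_manifold n M \<phi> \<xi> \<eta> g" and x: "x \<in> vfields M" and y: "y \<in> vfields M"
  shows "g (\<phi> x) y p = g x (\<phi> y) p"
proof -
  note phi = accR_manifold_phi_vfields[OF A]
  note g1 = accR_manifold_one_form(1)[OF A phi[OF x]]
  have xi: "\<xi> \<in> vfields M" and phi_xi: "\<phi> \<xi> = vzero"
    and eta_phi: "\<And>z. z \<in> vfields M \<Longrightarrow> \<eta> (\<phi> z) = (\<lambda>p. 0)"
    and phi2: "\<phi> (\<phi> y) = vsub (vscale (\<eta> y) \<xi>) y" and eta_y: "\<eta> y \<in> smooth_funs M"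
    using A y by (auto simp: accR_manifold_def one_form_def)
  have "g (\<phi> (\<phi> x)) (\<phi> \<xi>) p = 0"
    using one_form_vzero[OF accR_manifold_one_form(1)[OF A] accR_manifold_vzero[OF A]] phi x
    by (simp add: phi_xi)
  then have orth: "g (\<phi> x) \<xi> p = 0"
    using accR_manifold_g_phi_phi[OF A phi[OF x] xi, of p] eta_phi[OF x] by simp
  have "g (\<phi> x) (vadd (\<phi> (\<phi> y)) y) p = g (\<phi> x) (\<phi> (\<phi> y)) p + g (\<phi> x) y p"
    using g1 phi y by (simp add: one_form_def)
  moreover have "g (\<phi> x) (vadd (\<phi> (\<phi> y)) y) p = \<eta> y p * g (\<phi> x) \<xi> p"
    using g1 eta_y xi by (simp add: phi2 vadd_vsub_cancel one_form_def)
  moreover have "g (\<phi> x) (\<phi> (\<phi> y)) p = - g x (\<phi> y) p"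
    using accR_manifold_g_phi_phi[OF A x phi[OF y], of p] eta_phi[OF y] by simp
  ultimately show ?thesis
    using orth by simp
qed

section \<open>Vertical fields on Sasaki-like manifolds\<close>

text \<open>This is the Sasaki-like condition for \<open>(\<nabla>\<^sub>x \<phi>) V\<close>, in which \<open>\<nabla>\<^sub>x (\<phi> V)\<close> and
  \<open>g(\<phi> x, \<phi> V)\<close> vanish. For \<open>V = \<xi>\<close> it is the horizontal
  part of the familiar identity \<open>\<nabla>\<^sub>x \<xi> = - \<phi> x\<close>.\<close>

lemma sasaki_like_phi_deriv:
  assumes A: "accR_manifold n M \<phi> \<xi> \<eta> g" and D: "affine_connection M D"
    and S: "\<And>x y. x \<in> vfields M \<Longrightarrow> y \<in> vfields M \<Longrightarrow>
        vsub (D x (\<phi> y)) (\<phi> (D x y)) =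
        vadd (vscale (\<eta> y) (\<phi> (\<phi> x))) (vscale (g (\<phi> x) (\<phi> y)) \<xi>)"
    and V: "V \<in> vfields M" "\<phi> V = vzero" and x: "x \<in> vfields M" "\<eta> x = (\<lambda>p. 0)"
  shows "\<phi> (D x V) = vscale (\<eta> V) x"
proof -
  have "g (\<phi> x) vzero p = 0" for p
    using one_form_vzero[OF accR_manifold_one_form(1)[OF A] accR_manifold_vzero[OF A]]
      accR_manifold_phi_vfields[OF A x(1)] by simp
  then have "vsub vzero (\<phi> (D x V)) = vscale (\<eta> V) (\<phi> (\<phi> x))"
    using S[OF x(1) V(1)] affine_connection_vzero[OF D x(1) accR_manifold_vzero[OF A]] V(2)
    by (simp add: vadd_def vscale_def)
  moreover have "\<phi> (\<phi> x) = (\<lambda>f p. - x f p)"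
    by (rule accR_manifold_phi_phi_horizontal) (fact A x)+
  ultimately have "vsub vzero (\<phi> (D x V)) = vscale (\<eta> V) (\<lambda>f p. - x f p)"
    by simp
  from fun_cong[OF fun_cong[OF this]] have "\<phi> (D x V) f p = vscale (\<eta> V) x f p" for f p
    by (simp add: vsub_def vzero_def vscale_def)
  then show ?thesis
    by (intro ext)
qed

lemma sasaki_like_deriv_phi:
  assumes A: "accR_manifold n M \<phi> \<xi> \<eta> g"
    and S: "\<And>x y. x \<in> vfields M \<Longrightarrow> y \<in> vfields M \<Longrightarrow>
        vsub (D x (\<phi> y)) (\<phi> (D x y)) =
        vadd (vscale (\<eta> y) (\<phi> (\<phi> x))) (vscale (g (\<phi> x) (\<phi> y)) \<xi>)"
    and V: "V \<in> vfields M" "\<phi> V = vzero" and y: "y \<in> vfields M" "\<eta> y = (\<lambda>p. 0)"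
  shows "D V (\<phi> y) = \<phi> (D V y)"
proof -
  have "g vzero (\<phi> y) p = 0" for p
    using one_form_vzero[OF accR_manifold_one_form(2)[OF A] accR_manifold_vzero[OF A]]
      accR_manifold_phi_vfields[OF A y(1)] by simp
  then show ?thesis
    using S[OF V(1) y(1)] V(2) y(2) by (simp add: vsub_def vadd_def vscale_def fun_eq_iff)
qed

text \<open>Expressing derivatives and brackets by means of \<open>\<nabla>\<close>, the terms with \<open>\<nabla>\<^sub>V x\<close> and
  \<open>\<nabla>\<^sub>V y\<close> cancel because \<open>\<nabla>\<^sub>V\<close> commutes with \<open>\<phi>\<close> on horizontal fields. What is left is
  \<open>g(\<nabla>\<^sub>x V, \<phi> y) + g(x, \<phi>(\<nabla>\<^sub>y V))\<close>, and each summand is \<open>\<eta>(V) g(x, y)\<close>.\<close>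

lemma lie_derivative_associated_metric:
  assumes A: "accR_manifold n M \<phi> \<xi> \<eta> g" and SL: "sasaki_like M \<phi> \<xi> \<eta> g"
    and V: "V \<in> vfields M" "\<phi> V = vzero"
    and x: "x \<in> vfields M" "\<eta> x = (\<lambda>p. 0)" and y: "y \<in> vfields M" "\<eta> y = (\<lambda>p. 0)"
  shows "lie_derivative V (associated_metric \<phi> \<eta> g) x y p = 2 * \<eta> V p * g x y p"
proof -
  from SL obtain D where LC: "levi_civita M g D" and
    S: "\<And>x y. x \<in> vfields M \<Longrightarrow> y \<in> vfields M \<Longrightarrow>
        vsub (D x (\<phi> y)) (\<phi> (D x y)) =
        vadd (vscale (\<eta> y) (\<phi> (\<phi> x))) (vscale (g (\<phi> x) (\<phi> y)) \<xi>)"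
    unfolding sasaki_like_def by blast
  have D: "affine_connection M D"
    and bracket: "\<And>z. z \<in> vfields M \<Longrightarrow> lie_bracket V z = vsub (D V z) (D z V)"
    using LC V(1) by (auto simp: levi_civita_def)
  have M: "smooth_manifold M" and endo: "endomorphism_field M \<phi>"
    and eta_V: "\<eta> V \<in> smooth_funs M"
    using A V(1) by (auto simp: accR_manifold_def one_form_def)
  note phi = accR_manifold_phi_vfields[OF A] and Dv = affine_connection_vfields[OF D]
  have deriv_phi: "D V (\<phi> y) = \<phi> (D V y)"
    by (rule sasaki_like_deriv_phi[of n M \<phi> \<xi> \<eta> g D V y, OF A S V y])
  have phi_deriv: "\<phi> (D z V) = vscale (\<eta> V) z" if z: "z \<in> vfields M" "\<eta> z = (\<lambda>p. 0)" for z
    by (rule sasaki_like_phi_deriv[of n M \<phi> \<xi> \<eta> g D V z, OF A D S V z])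
  have "V (g x (\<phi> y)) = (\<lambda>p. g (D V x) (\<phi> y) p + g x (D V (\<phi> y)) p)"
    using LC V(1) x(1) phi[OF y(1)] unfolding levi_civita_def by blast
  then have "V (g x (\<phi> y)) p = g (D V x) (\<phi> y) p + g x (\<phi> (D V y)) p"
    by (simp add: deriv_phi)
  moreover have "g (lie_bracket V x) (\<phi> y) p = g (D V x) (\<phi> y) p - g (D x V) (\<phi> y) p"
    unfolding bracket[OF x(1)]
    by (rule one_form_vsub[OF M accR_manifold_one_form(2)[OF A phi[OF y(1)]]]) (intro Dv V x)+
  moreover have "g x (\<phi> (lie_bracket V y)) p = g x (\<phi> (D V y)) p - g x (\<phi> (D y V)) p"
    unfolding bracket[OF y(1)] endomorphism_field_vsub[OF M endo Dv[OF V(1) y(1)] Dv[OF y(1) V(1)]]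
    by (rule one_form_vsub[OF M accR_manifold_one_form(1)[OF A x(1)]]) (intro phi Dv V y)+
  moreover have "g (D x V) (\<phi> y) p = \<eta> V p * g x y p"
  proof -
    have "g (D x V) (\<phi> y) p = g (\<phi> (D x V)) y p"
      using accR_manifold_phi_self_adjoint[OF A Dv[OF x(1) V(1)] y(1)] by simp
    also have "\<dots> = \<eta> V p * g x y p"
      using accR_manifold_one_form(2)[OF A y(1)] eta_V x(1)
      by (simp add: phi_deriv[OF x] one_form_def)
    finally show ?thesis .
  qed
  moreover have "g x (\<phi> (D y V)) p = \<eta> V p * g x y p"
    using accR_manifold_one_form(1)[OF A x(1)] eta_V y(1)
    by (simp add: phi_deriv[OF y] one_form_def)
  ultimately show ?thesis
    by (simp add: lie_derivative_def associated_metric_def x(2) y(2))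
qed

section \<open>Nonexistence of vertical solitons\<close>

theorem theorem4p3:
  fixes n :: nat and M :: "('a, 'm::finite) mfd" and \<phi> :: "'a endo" and \<xi> :: "'a vfield"
    and \<eta> :: "'a oneform" and g :: "'a bilin"
  assumes "accR_manifold n M \<phi> \<xi> \<eta> g"
    and "sasaki_like M \<phi> \<xi> \<eta> g"
  shows "\<not> (\<exists>V l. yamabe_almost_soliton M (associated_metric \<phi> \<eta> g) V l \<and>
                vertical_potential M \<xi> V)"
proof
  assume "\<exists>V l. yamabe_almost_soliton M (associated_metric \<phi> \<eta> g) V l \<and>
    vertical_potential M \<xi> V"
  then obtain V l where sol: "yamabe_almost_soliton M (associated_metric \<phi> \<eta> g) V l"
    and vert: "vertical_potential M \<xi> V"
    by (elim exE conjE)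
  from vert obtain k where k_smooth: "k \<in> smooth_funs M"
    and k_nonzero: "\<forall>p\<in>points M. k p \<noteq> 0" and V_eq: "V = vscale k \<xi>"
    unfolding vertical_potential_def by (elim bexE conjE)
  note A = assms(1)
  note phi = accR_manifold_phi_vfields[OF A]
  have V: "V \<in> vfields M"
    using sol unfolding yamabe_almost_soliton_def by (rule conjunct1)
  have xi: "\<xi> \<in> vfields M" and n: "n \<ge> 1" and phi_xi: "\<phi> \<xi> = vzero"
    and endo: "endomorphism_field M \<phi>" and eta: "one_form M \<eta>"
    and eta_xi: "\<And>p. p \<in> points M \<Longrightarrow> \<eta> \<xi> p = 1"
    and eta_phi: "\<And>z. z \<in> vfields M \<Longrightarrow> \<eta> (\<phi> z) = (\<lambda>p. 0)"
    and metric: "pseudo_riemannian_metric M g (n + 1) n" and ne: "points M \<noteq> {}"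
    using A unfolding accR_manifold_def smooth_manifold_def by blast+
  have phi_V: "\<phi> V = vzero"
    using endo k_smooth xi
    by (simp add: V_eq endomorphism_field_def phi_xi) (simp add: vscale_def vzero_def)
  obtain p where p: "p \<in> points M"
    using ne by blast
  have eta_V: "\<eta> V p = k p"
    using eta k_smooth xi eta_xi[OF p] by (simp add: V_eq one_form_def)
  define s where "s = scalar_curvature M (associated_metric \<phi> \<eta> g) p - l p"
  have key: "k p * g x y p = s * g x (\<phi> y) p"
    if "x \<in> vfields M" "\<eta> x = (\<lambda>p. 0)" "y \<in> vfields M" "\<eta> y = (\<lambda>p. 0)" for x y
  proof -
    have "1 / 2 * lie_derivative V (associated_metric \<phi> \<eta> g) x y p
        = s * associated_metric \<phi> \<eta> g x y p"
      using sol that(1,3) p unfolding yamabe_almost_soliton_def s_def by blast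
    moreover have "lie_derivative V (associated_metric \<phi> \<eta> g) x y p = 2 * \<eta> V p * g x y p"
      by (rule lie_derivative_associated_metric) (fact A assms(2) V phi_V that)+
    moreover have "associated_metric \<phi> \<eta> g x y p = g x (\<phi> y) p"
      by (simp add: associated_metric_def that(2))
    ultimately show ?thesis
      by (simp add: eta_V)
  qed
  have "has_signature_at M g p (n + 1) n"
    using metric p unfolding pseudo_riemannian_metric_def by (elim conjE bspec)
  then obtain E where E: "tangent_frame_at M p E" "card {i. g (E i) (E i) p = - 1} = n"
    unfolding has_signature_at_def by (elim exE conjE)
  with n have "{i. g (E i) (E i) p = - 1} \<noteq> {}"
    by (intro notI) simp
  then obtain i where i: "g (E i) (E i) p = - 1"
    by blast
  define e where "e = E i"
  have e: "e \<in> vfields M" "g e e p = - 1"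
    using E(1) i by (simp_all add: e_def tangent_frame_at_def)
  define x where "x = \<phi> e"
  have x: "x \<in> vfields M" "\<eta> x = (\<lambda>p. 0)"
    unfolding x_def by (rule phi[OF e(1)], rule eta_phi[OF e(1)])
  have pos: "g x x p > 0"
    using accR_manifold_g_phi_phi[OF A e(1) e(1), of p] e(2)
    by (simp add: x_def add_pos_nonneg)
  have "g x (\<phi> (\<phi> x)) p = - g x x p"
    using accR_manifold_g_phi_phi[OF A x(1) x(1), of p] x(2)
      accR_manifold_phi_self_adjoint[OF A x(1) phi[OF x(1)], of p] by simp
  then have k_phi: "k p * g x (\<phi> x) p = - s * g x x p"
    using key[OF x phi[OF x(1)] eta_phi[OF x(1)]] by simp
  have k_id: "k p * g x x p = s * g x (\<phi> x) p"
    by (rule key[OF x x])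
  have "(k p)\<^sup>2 * g x x p = k p * (s * g x (\<phi> x) p)"
    unfolding power2_eq_square mult.assoc k_id ..
  also have "\<dots> = s * (k p * g x (\<phi> x) p)"
    by (rule mult.left_commute)
  also have "\<dots> = - s\<^sup>2 * g x x p"
    unfolding k_phi by (simp add: power2_eq_square)
  finally have "((k p)\<^sup>2 + s\<^sup>2) * g x x p = 0"
    by (simp add: distrib_right)
  then have "(k p)\<^sup>2 + s\<^sup>2 = 0"
    using pos by simp
  then show False
    using k_nonzero p by (simp add: sum_power2_eq_zero_iff)
qed

end
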